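(* Let $i,j$ be two vertices of the $d$-dimensional hypercube and let $P$ be its diffusion matrix. Then the function $t\mapsto (P^t)_{i,j}$, $t\in\mathbb{N}$, is unimodal.
   Context: The $d$-dimensional hypercube has vertex set $\{0,1\}^d$, vertices adjacent iff they differ in exactly one bit. Its diffusion matrix is $P_{i,j}=1/(2d)$ if $i,j$ are adjacent, $P_{i,i}=1/2$, and $0$ otherwise (the transition matrix of the lazy random walk). A function $f:\mathbb{N}\to\mathbb{R}$ is unimodal if there is $s\in\mathbb{N}$ such that $f$ restricted to $\{x\le s\}$ and $f$ restricted to $\{x\ge s\}$ are each monotone. *)

theory Defs
  imports "HOL-Analysis.Analysis"
begin

text \<open>The dimension \<open>d\<close> is \<open>CARD('d)\<close> for an arbitrary finite index type \<open>'d\<close>, so \<open>d \<ge> 1\<close>;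
  \<open>False\<close> and \<open>True\<close> stand for the bits 0 and 1.\<close>

type_synonym 'd hypercube = "bool ^ 'd"

definition hypercube_adj :: "'d::finite hypercube \<Rightarrow> 'd hypercube \<Rightarrow> bool" where
  "hypercube_adj x y \<longleftrightarrow> card {k. x $ k \<noteq> y $ k} = 1"

definition diffusion_matrix :: "real ^ ('d::finite hypercube) ^ ('d hypercube)" where
  "diffusion_matrix = (\<chi> i j. if hypercube_adj i j then 1 / (2 * real CARD('d))
                              else if i = j then 1 / 2 else 0)"

text \<open>On type \<open>vec\<close> the operators \<open>*\<close> and \<open>^\<close> act entrywise, so powers with respect
  to the matrix product need a definition of their own.\<close>

primrec matrix_power :: "real ^ 'n ^ 'n \<Rightarrow> nat \<Rightarrow> real ^ 'n ^ 'n" where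
  "matrix_power A 0 = mat 1"
| "matrix_power A (Suc t) = A ** matrix_power A t"

text \<open>Each of the two pieces may be monotone in either direction.\<close>

definition unimodal :: "(nat \<Rightarrow> real) \<Rightarrow> bool" where
  "unimodal f \<longleftrightarrow> (\<exists>s. (mono_on {..s} f \<or> antimono_on {..s} f) \<and>
                      (mono_on {s..} f \<or> antimono_on {s..} f))"

end

theory Submission
  imports Defs
begin

text \<open>One step of the walk picks a uniformly random coordinate and re-randomises its bit. If \<open>n\<close>
  coordinates have been picked so far, they form a uniformly random \<open>n\<close>-set \<open>S\<close>, and the walk is at a
  given vertex at distance \<open>k\<close> from the start with probability
  \<open>w(n) = 2\<^sup>-\<^sup>n Pr(S contains the k differing coordinates)\<close>. Hence \<open>(P\<^sup>t)\<^sub>i\<^sub>j\<close> is the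
  expectation of \<open>w(N\<^sub>t)\<close>, where \<open>N\<^sub>t\<close> is the coupon collector chain, which moves
  from \<open>n\<close> to \<open>n + 1\<close> with probability \<open>1 - n/d\<close>. The sequence \<open>w\<close> increases and then decreases,
  and the transition operator of a pure birth chain preserves the property of being
  nonnegative up to some threshold and nonpositive from there on, without raising the threshold.
  Applied to the increments, this shows that the increments of \<open>(P\<^sup>t)\<^sub>i\<^sub>j\<close> change sign at most once.\<close>

subsection \<open>The coupon collector operator\<close>

text \<open>One backward step of the collector chain. At \<open>n = d\<close> the coefficient of
  \<open>f (Suc n)\<close> is zero, so the values on 0..d determine each other; beyond
  \<open>d\<close> the weights are not probabilities, hence the recurring restriction to
  \<open>n \<le> d\<close>.\<close>

definition collect :: "nat \<Rightarrow> (nat \<Rightarrow> real) \<Rightarrow> nat \<Rightarrow> real" where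
  "collect d f n = real n / real d * f n + (1 - real n / real d) * f (Suc n)"

definition crosses_down_at :: "nat \<Rightarrow> nat \<Rightarrow> (nat \<Rightarrow> real) \<Rightarrow> bool" where
  "crosses_down_at d s e \<longleftrightarrow> (\<forall>n\<le>d. (n < s \<longrightarrow> 0 \<le> e n) \<and> (s \<le> n \<longrightarrow> e n \<le> 0))"

lemma collect_diff: "collect d (\<lambda>n. f n - g n) = (\<lambda>n. collect d f n - collect d g n)"
  by (simp add: collect_def fun_eq_iff right_diff_distrib)

text \<open>By linearity of \<open>collect d\<close>, time increments of an iterate are iterates of
  the initial increment, so sign patterns of the latter can be propagated.\<close>

lemma collect_iterate_increment:
  "(collect d ^^ t) (\<lambda>n. collect d f n - f n) n = (collect d ^^ Suc t) f n - (collect d ^^ t) f n"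
proof (induction t arbitrary: n)
  case (Suc t)
  then have "(collect d ^^ t) (\<lambda>n. collect d f n - f n)
      = (\<lambda>n. (collect d ^^ Suc t) f n - (collect d ^^ t) f n)"
    by blast
  then show ?case
    by (simp add: collect_diff)
qed simp

lemma collect_cong:
  assumes "0 < d" "n \<le> d" "f n = g n" "n < d \<Longrightarrow> f (Suc n) = g (Suc n)"
  shows "collect d f n = collect d g n"
  using assms by (cases "n = d") (auto simp: collect_def)

lemma collect_nonneg:
  assumes "0 < d" "n \<le> d" "0 \<le> f n" "n < d \<Longrightarrow> 0 \<le> f (Suc n)"
  shows "0 \<le> collect d f n"
proof (cases "n = d")
  case False
  with assms show ?thesis
    unfolding collect_def by (intro add_nonneg_nonneg mult_nonneg_nonneg) auto
qed (use assms in \<open>simp add: collect_def\<close>)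

lemma collect_nonpos:
  assumes "0 < d" "n \<le> d" "f n \<le> 0" "n < d \<Longrightarrow> f (Suc n) \<le> 0"
  shows "collect d f n \<le> 0"
proof -
  have "0 \<le> collect d (\<lambda>n. - f n) n"
    using assms by (intro collect_nonneg) auto
  then show ?thesis
    by (simp add: collect_def)
qed

lemma collect_crosses_down:
  assumes "0 < d" "crosses_down_at d s e"
  obtains s' where "s' \<le> s" "crosses_down_at d s' (collect d e)"
proof -
  have pos: "0 \<le> collect d e n" if "n \<le> d" "Suc n < s" for n
    using that assms by (intro collect_nonneg) (auto simp: crosses_down_at_def)
  have neg: "collect d e n \<le> 0" if "n \<le> d" "s \<le> n" for n
    using that assms by (intro collect_nonpos) (auto simp: crosses_down_at_def)
  show thesis
  \<comment> \<open>\<open>collect d e n\<close> averages \<open>e n\<close> and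
    \<open>e (Suc n)\<close>, which can have opposite signs only at \<open>n = s - 1\<close>. The
    sign of that one average decides whether the threshold drops by one or stays.\<close>
  proof (cases "collect d e (s - 1) \<le> 0")
    case True
    have "crosses_down_at d (s - 1) (collect d e)"
      unfolding crosses_down_at_def
    proof (intro allI impI conjI)
      fix n assume n: "n \<le> d" "s - 1 \<le> n"
      then consider "n = s - 1" | "s \<le> n" by linarith
      then show "collect d e n \<le> 0"
        using True neg n by cases auto
    qed (use pos in auto)
    then show thesis
      using that[of "s - 1"] by simp
  next
    case False
    have "crosses_down_at d s (collect d e)"
      unfolding crosses_down_at_def
    proof (intro allI impI conjI)
      fix n assume n: "n \<le> d" "n < s"
      then consider "n = s - 1" | "Suc n < s" by linarith
      then show "0 \<le> collect d e n"
        using False pos n by cases auto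
    qed (use neg in auto)
    then show thesis
      using that[of s] by simp
  qed
qed

lemma collect_iterate_crosses_down:
  assumes "0 < d" "crosses_down_at d s e"
  shows "\<exists>s'. crosses_down_at d s' ((collect d ^^ t) e)"
proof (induction t)
  case 0
  then show ?case using assms(2) by auto
next
  case (Suc t)
  then show ?case
    using collect_crosses_down[OF assms(1)] by (metis comp_apply funpow.simps(2))
qed

text \<open>A negative value at 0 forces the threshold to be 0, and thresholds never rise.\<close>

lemma collect_iterate_stays_nonpos:
  assumes "0 < d" "crosses_down_at d s e" "(collect d ^^ t) e 0 < 0" "t \<le> u"
  shows "(collect d ^^ u) e 0 \<le> 0"
proof -
  obtain s' where s': "crosses_down_at d s' ((collect d ^^ t) e)"
    using collect_iterate_crosses_down assms by blast
  then have "s' = 0"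
    using assms(3) unfolding crosses_down_at_def by (metis gr0I leD le0)
  have "crosses_down_at d 0 ((collect d ^^ u) e)"
    using assms(4)
  proof (induction u rule: dec_induct)
    case base
    then show ?case using s' \<open>s' = 0\<close> by simp
  next
    case (step m)
    then show ?case
      using collect_crosses_down[OF assms(1) step.IH] by (metis comp_apply funpow.simps(2) le_zero_eq)
  qed
  then show ?thesis
    by (simp add: crosses_down_at_def)
qed

lemma unimodal_if_increments_cross_down:
  assumes "\<And>t u. f (Suc t) - f t < 0 \<Longrightarrow> t \<le> u \<Longrightarrow> f (Suc u) - f u \<le> 0"
  shows "unimodal f"
proof (cases "\<exists>t. f (Suc t) - f t < 0")
  case True
  \<comment> \<open>The peak is placed at the first strict decrease; without one the function is
    monotone.\<close>
  define T where "T = (LEAST t. f (Suc t) - f t < 0)"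
  have T: "f (Suc T) - f T < 0"
    unfolding T_def using True by (rule LeastI_ex)
  have up: "f t \<le> f (Suc t)" if "t < T" for t
    using not_less_Least[OF that[unfolded T_def]] by simp
  have "f a \<le> f b" if "a \<le> b" "b \<le> T" for a b
    using that
  proof (induction b rule: dec_induct)
    case (step n)
    then show ?case using up[of n] by simp
  qed simp
  then have "mono_on {..T} f"
    by (auto simp: mono_on_def)
  moreover have "f b \<le> f a" if "a \<le> b" "T \<le> a" for a b
    using that
  proof (induction b rule: dec_induct)
    case (step n)
    then show ?case using assms[OF T, of n] by linarith
  qed simp
  then have "antimono_on {T..} f"
    by (auto simp: monotone_on_def)
  ultimately show ?thesis
    unfolding unimodal_def by blast
next
  case False
  then have "mono f"
    by (auto simp: mono_iff_le_Suc not_less)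
  then show ?thesis
    unfolding unimodal_def by (meson mono_imp_mono_on)
qed

subsection \<open>The probability of a vertex given the number of picked coordinates\<close>

text \<open>The binomial quotient is the probability that a uniformly random \<open>n\<close>-subset of \<open>d\<close> elements
  contains \<open>k\<close> given ones. The lower index \<open>d - n\<close>, rather than the equivalent \<open>n - k\<close>, makes it
  vanish for \<open>n < k\<close> despite truncated subtraction.\<close>

definition cover_weight :: "nat \<Rightarrow> nat \<Rightarrow> nat \<Rightarrow> real" where
  "cover_weight d k n = real ((d - k) choose (d - n)) / (2 ^ n * real (d choose n))"

lemma cover_weight_0:
  assumes "k \<le> d"
  shows "cover_weight d k 0 = (if k = 0 then 1 else 0)"
  using assms by (auto simp: cover_weight_def)

lemma cover_weight_nonneg: "0 \<le> cover_weight d k n"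
  by (simp add: cover_weight_def)

lemma binomial_diff_absorb:
  "(real a - real b) * real (a choose b) = real (Suc b) * real (a choose Suc b)"
proof (cases "b \<le> a")
  case True
  have "(a choose b) * (a - b) = (a choose Suc b) * Suc b"
    by (metis binomial_absorb_comp binomial_absorption mult.commute)
  then show ?thesis
    using True by (metis mult.commute of_nat_diff of_nat_mult)
qed (simp add: binomial_eq_0)

text \<open>The ratio of consecutive weights, cross-multiplied because at \<open>n + 1 = k\<close>
  the weight jumps from zero to a positive value.\<close>

lemma cover_weight_Suc:
  assumes "k \<le> d" "n < d"
  shows "2 * (real n + 1 - real k) * cover_weight d k (Suc n) = (real n + 1) * cover_weight d k n"
proof -
  obtain b where b: "d = n + Suc b"
    using assms(2) less_imp_Suc_add by fastforce
  have 1: "(real n + 1 - real k) * real ((d - k) choose b)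
      = (real b + 1) * real ((d - k) choose Suc b)"
    using binomial_diff_absorb[of "d - k" b] assms b by (simp add: of_nat_diff algebra_simps)
  have 2: "(real b + 1) * real (d choose n) = (real n + 1) * real (d choose Suc n)"
    using binomial_diff_absorb[of d n] b by (simp add: algebra_simps)
  have nz: "real (d choose n) \<noteq> 0" "real (d choose Suc n) \<noteq> 0"
    using assms by auto
  have cancel: "2 * x * (y / (2 ^ Suc n * z)) = x * y / (2 ^ n * z)" for x y z :: real
    by simp
  have "d - Suc n = b"
    using b by simp
  then have "2 * (real n + 1 - real k) * cover_weight d k (Suc n)
      = ((real n + 1 - real k) * real ((d - k) choose b)) / (2 ^ n * real (d choose Suc n))"
    unfolding cover_weight_def cancel by simp
  also have "\<dots> = (real n + 1) * cover_weight d k n"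
    unfolding 1 using nz b 2
    by (simp add: cover_weight_def divide_simps del: binomial_Suc_Suc)
  finally show ?thesis .
qed

text \<open>For \<open>n \<ge> k\<close> the ratio \<open>(n + 1) / (2 * (n + 1 - k))\<close> is at
  least 1 exactly when \<open>n + 1 \<le> 2 * k\<close>. For \<open>k = 0\<close> truncation gives
  threshold 0, as the weight then decreases from the start.\<close>

lemma cover_weight_increment_crosses_down:
  assumes "k \<le> d" "0 < d"
  shows "crosses_down_at d (2 * k - 1) (\<lambda>n. collect d (cover_weight d k) n - cover_weight d k n)"
proof -
  let ?w = "cover_weight d k"
  have eq: "collect d ?w n - ?w n = (1 - real n / real d) * (?w (Suc n) - ?w n)" for n
    by (simp add: collect_def algebra_simps)
  have up: "?w n \<le> ?w (Suc n)" if "n < d" "n < 2 * k - 1" for n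
  proof (cases "n < k")
    case True
    then have "?w n = 0"
      using assms that by (simp add: cover_weight_def)
    then show ?thesis by (simp add: cover_weight_nonneg)
  next
    case False
    have "n + 2 \<le> 2 * k" using that by simp
    then have "real n + 2 \<le> 2 * real k"
      by (simp flip: of_nat_le_iff[where 'a = real])
    then have le: "2 * (real n + 1 - real k) \<le> real n + 1"
      by (simp add: algebra_simps)
    have "(real n + 1) * ?w n = 2 * (real n + 1 - real k) * ?w (Suc n)"
      using cover_weight_Suc[OF assms(1) that(1)] by simp
    also have "\<dots> \<le> (real n + 1) * ?w (Suc n)"
      by (intro mult_right_mono le cover_weight_nonneg)
    finally show ?thesis by simp
  qed
  have down: "?w (Suc n) \<le> ?w n" if "n < d" "2 * k - 1 \<le> n" for n
  proof -
    have "2 * k \<le> n + 1" using that by simp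
    then have "2 * real k \<le> real n + 1"
      by (simp flip: of_nat_le_iff[where 'a = real])
    then have le: "real n + 1 \<le> 2 * (real n + 1 - real k)"
      by (simp add: algebra_simps)
    have "(real n + 1) * ?w (Suc n) \<le> 2 * (real n + 1 - real k) * ?w (Suc n)"
      by (intro mult_right_mono le cover_weight_nonneg)
    also have "\<dots> = (real n + 1) * ?w n"
      by (rule cover_weight_Suc[OF assms(1) that(1)])
    finally show ?thesis by simp
  qed
  show ?thesis
    unfolding crosses_down_at_def eq
  proof (intro allI conjI impI)
    fix n assume n: "n \<le> d"
    show "0 \<le> (1 - real n / real d) * (?w (Suc n) - ?w n)" if "n < 2 * k - 1"
      using n that up[of n] \<open>0 < d\<close> by (cases "n = d") (auto simp: divide_simps)
    show "(1 - real n / real d) * (?w (Suc n) - ?w n) \<le> 0" if "2 * k - 1 \<le> n"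
      using n that down[of n] \<open>0 < d\<close> by (cases "n = d") (auto simp: divide_simps mult_le_0_iff)
  qed
qed

text \<open>The left side is a step of the lazy walk on a function of the distance: \<open>k\<close>
  neighbours are closer to the target and \<open>d - k\<close> farther. The out-of-range cases
  \<open>k - 1\<close> at \<open>k = 0\<close> and \<open>Suc k\<close> at \<open>k = d\<close>
  carry coefficient zero.\<close>

lemma cover_weight_step:
  assumes "k \<le> d" "n \<le> d" "0 < d"
  shows "cover_weight d k n / 2 + (real k * cover_weight d (k - 1) n
      + (real d - real k) * cover_weight d (Suc k) n) / (2 * real d)
    = collect d (cover_weight d k) n"
proof -
  have nz: "real (d choose n) \<noteq> 0"
    using assms by auto
  have succ: "(real d - real k) * real ((d - Suc k) choose (d - n))
      = (real n - real k) * real ((d - k) choose (d - n))"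
  proof (cases "k = d")
    case True
    then show ?thesis using assms by (cases "n = d") auto
  next
    case False
    then obtain a where a: "d - k = Suc a" "d = k + Suc a"
      using assms by (metis Suc_diff_Suc le_add_diff_inverse le_neq_implies_less)
    have "Suc a * (a choose (d - n)) = (Suc a - (d - n)) * (Suc a choose (d - n))"
      using binomial_absorb_comp[of "Suc a" "d - n"] by simp
    then have "real (Suc a) * real (a choose (d - n))
        = real (Suc a - (d - n)) * real (Suc a choose (d - n))"
      by (metis of_nat_mult)
    also have "\<dots> = (real n - real k) * real (Suc a choose (d - n))"
      using a assms by (cases "d - n \<le> Suc a") (auto simp: of_nat_diff)
    finally show ?thesis
      using a by simp
  qed
  show ?thesis
  proof (cases "n = d")
    case True
    then show ?thesis
      using assms by (simp add: cover_weight_def collect_def field_simps)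
  next
    case False
    then have "n < d" using assms by simp
    then obtain b where b: "d - n = Suc b" "d = n + Suc b"
      by (metis Suc_diff_Suc add_diff_inverse_nat not_less_iff_gr_or_eq)
    have pred: "real k * real ((d - (k - 1)) choose (d - n))
        = real k * (real ((d - k) choose (d - n)) + real ((d - k) choose b))"
    proof (cases k)
      case (Suc k')
      then have "d - k' = Suc (d - k)" using assms by simp
      then show ?thesis using Suc b by simp
    qed simp
    have absorb: "(real n + 1 - real k) * real ((d - k) choose b)
        = (real d - real n) * real ((d - k) choose (d - n))"
      using binomial_diff_absorb[of "d - k" b] assms b by (simp add: of_nat_diff algebra_simps)
    have choose: "(real d - real n) * real (d choose n) = (real n + 1) * real (d choose Suc n)"
      using binomial_diff_absorb[of d n] by (simp add: algebra_simps)
    have nz': "real (d choose Suc n) \<noteq> 0"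
      using \<open>n < d\<close> by auto
    \<comment> \<open>Pascal's rule for \<open>k - 1\<close> and absorption for \<open>k + 1\<close>
      express all weights through the two binomials \<open>A\<close> and \<open>B\<close>.\<close>
    define q where "q = 2 ^ n * real (d choose n)"
    define A where "A = real ((d - k) choose (d - n))"
    define B where "B = real ((d - k) choose b)"
    have q: "q \<noteq> 0" unfolding q_def using nz by simp
    have w: "cover_weight d k n = A / q"
      "real k * cover_weight d (k - 1) n = real k * (A + B) / q"
      "(real d - real k) * cover_weight d (Suc k) n = (real n - real k) * A / q"
      using pred succ by (simp_all add: cover_weight_def A_def B_def q_def)
    have "(real d - real n) * cover_weight d k (Suc n)
        = (real d - real n) * B / (2 * 2 ^ n * real (d choose Suc n))"
      using b by (simp add: cover_weight_def B_def del: binomial_Suc_Suc)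
    also have "\<dots> = (real n + 1) * B / (2 * q)"
      using choose nz nz' by (simp add: q_def divide_simps del: binomial_Suc_Suc)
    finally have w': "(real d - real n) * cover_weight d k (Suc n) = (real n + 1) * B / (2 * q)" .
    have "collect d (cover_weight d k) n
        = (real n * cover_weight d k n + (real d - real n) * cover_weight d k (Suc n)) / real d"
      using assms by (simp add: collect_def field_simps)
    also have "\<dots> = (real n * A + (real n + 1) * B / 2) / (real d * q)"
      unfolding w' unfolding w using q assms by (simp add: field_simps)
    \<comment> \<open>The two sides differ by \<open>(n + 1 - k) * B - (d - n) * A\<close>, which
      \<open>absorb\<close> makes zero.\<close>
    also have "2 * (real n * A + (real n + 1) * B / 2)
        = real d * A + real k * (A + B) + (real n - real k) * A"
      using absorb unfolding A_def[symmetric] B_def[symmetric] by (simp add: field_simps)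
    then have "(real n * A + (real n + 1) * B / 2) / (real d * q)
        = (real d * A + real k * (A + B) + (real n - real k) * A) / (2 * (real d * q))"
      by (simp add: field_simps)
    also have "\<dots> = A / q / 2 + (real k * (A + B) / q + (real n - real k) * A / q) / (2 * real d)"
      using q assms by (simp add: field_simps)
    finally show ?thesis
      unfolding w by simp
  qed
qed

subsection \<open>The walk on the hypercube\<close>

definition flip :: "'d::finite \<Rightarrow> 'd hypercube \<Rightarrow> 'd hypercube" where
  "flip c x = (\<chi> m. if m = c then \<not> x $ m else x $ m)"

definition hamming :: "'d::finite hypercube \<Rightarrow> 'd hypercube \<Rightarrow> nat" where
  "hamming x y = card {m. x $ m \<noteq> y $ m}"

lemma hamming_le: "hamming x y \<le> CARD('d)" for x y :: "'d::finite hypercube"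
  unfolding hamming_def by (rule card_mono) auto

lemma hamming_eq_0_iff: "hamming x y = 0 \<longleftrightarrow> x = y"
  by (simp add: hamming_def vec_eq_iff)

lemma hamming_flip:
  "hamming (flip c x) y = (if x $ c \<noteq> y $ c then hamming x y - 1 else Suc (hamming x y))"
proof (cases "x $ c = y $ c")
  case True
  then have "{m. flip c x $ m \<noteq> y $ m} = insert c {m. x $ m \<noteq> y $ m}"
    by (auto simp: flip_def)
  then show ?thesis
    using True by (simp add: hamming_def)
next
  case False
  then have "{m. flip c x $ m \<noteq> y $ m} = {m. x $ m \<noteq> y $ m} - {c}"
    by (auto simp: flip_def)
  then show ?thesis
    using False by (simp add: hamming_def)
qed

lemma inj_flip: "inj (\<lambda>c. flip c x)"
  by (rule injI) (auto simp: flip_def vec_eq_iff split: if_splits)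

lemma hypercube_adj_iff_flip: "hypercube_adj x y \<longleftrightarrow> y \<in> range (\<lambda>c. flip c x)"
proof
  assume "hypercube_adj x y"
  then obtain c where c: "{k. x $ k \<noteq> y $ k} = {c}"
    unfolding hypercube_adj_def by (meson card_1_singletonE)
  then have "x $ k \<noteq> y $ k \<longleftrightarrow> k = c" for k
    by blast
  then have "y = flip c x"
    by (auto simp: flip_def vec_eq_iff)
  then show "y \<in> range (\<lambda>c. flip c x)"
    by blast
next
  assume "y \<in> range (\<lambda>c. flip c x)"
  then obtain c where "y = flip c x"
    by blast
  then have "{k. x $ k \<noteq> y $ k} = {c}"
    by (auto simp: flip_def)
  then show "hypercube_adj x y"
    by (simp add: hypercube_adj_def)
qed

text \<open>Flips enumerate each neighbour exactly once, so a sum over neighbours becomes a sum over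
  coordinates.\<close>

lemma diffusion_matrix_sum:
  fixes i :: "'d::finite hypercube"
  shows "(\<Sum>l\<in>UNIV. diffusion_matrix $ i $ l * g l)
    = g i / 2 + (\<Sum>c\<in>UNIV. g (flip c i)) / (2 * real CARD('d))"
proof -
  let ?R = "range (\<lambda>c. flip c i)"
  have "\<not> hypercube_adj i i"
    by (simp add: hypercube_adj_def)
  then have "diffusion_matrix $ i $ l * g l
      = (if l = i then g i / 2 else 0) + (if l \<in> ?R then g l / (2 * real CARD('d)) else 0)" for l
    by (auto simp: diffusion_matrix_def hypercube_adj_iff_flip[symmetric])
  then have "(\<Sum>l\<in>UNIV. diffusion_matrix $ i $ l * g l)
      = g i / 2 + (\<Sum>l\<in>UNIV. if l \<in> ?R then g l / (2 * real CARD('d)) else 0)"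
    by (simp only: sum.distrib) simp
  also have "(\<Sum>l\<in>UNIV. if l \<in> ?R then g l / (2 * real CARD('d)) else 0)
      = (\<Sum>l\<in>?R. g l / (2 * real CARD('d)))"
    by (subst sum.inter_restrict[symmetric]) auto
  also have "\<dots> = (\<Sum>c\<in>UNIV. g (flip c i)) / (2 * real CARD('d))"
    by (subst sum.reindex[OF inj_flip]) (simp add: sum_divide_distrib)
  finally show ?thesis .
qed

lemma diffusion_cover_weight:
  fixes i j :: "'d::finite hypercube"
  assumes "n \<le> CARD('d)"
  shows "(\<Sum>l\<in>UNIV. diffusion_matrix $ i $ l * cover_weight CARD('d) (hamming l j) n)
    = collect CARD('d) (cover_weight CARD('d) (hamming i j)) n"
proof -
  let ?w = "\<lambda>k. cover_weight CARD('d) k n" and ?k = "hamming i j"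
  define D where "D = {c. i $ c \<noteq> j $ c}"
  have "card D = ?k"
    by (simp add: D_def hamming_def)
  have "(\<Sum>c\<in>UNIV. ?w (hamming (flip c i) j))
      = (\<Sum>c\<in>D. ?w (hamming (flip c i) j)) + (\<Sum>c\<in>-D. ?w (hamming (flip c i) j))"
    by (subst sum.union_disjoint[symmetric]) (auto intro: sum.cong)
  also have "\<dots> = (\<Sum>c\<in>D. ?w (?k - 1)) + (\<Sum>c\<in>-D. ?w (Suc ?k))"
    by (intro arg_cong2[of _ _ _ _ "(+)"] sum.cong) (auto simp: hamming_flip D_def)
  also have "\<dots> = real ?k * ?w (?k - 1) + (real CARD('d) - real ?k) * ?w (Suc ?k)"
    using hamming_le[of i j] \<open>card D = ?k\<close>
    by (simp add: Compl_eq_Diff_UNIV card_Diff_subset of_nat_diff)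
  finally show ?thesis
    using cover_weight_step[OF hamming_le assms, of i j]
    by (simp add: diffusion_matrix_sum)
qed

text \<open>The matrix acts on the vertex and \<open>collect\<close> on \<open>n\<close>, so they
  commute, and the one-step identity passes to all iterates.\<close>

lemma diffusion_collect_iterate:
  fixes i j :: "'d::finite hypercube"
  assumes "n \<le> CARD('d)"
  shows "(\<Sum>l\<in>UNIV. diffusion_matrix $ i $ l
        * (collect CARD('d) ^^ t) (cover_weight CARD('d) (hamming l j)) n)
    = (collect CARD('d) ^^ Suc t) (cover_weight CARD('d) (hamming i j)) n"
  using assms
proof (induction t arbitrary: n)
  case 0
  then show ?case by (simp add: diffusion_cover_weight)
next
  case (Suc t)
  let ?d = "CARD('d)"
  let ?F = "\<lambda>l. (collect ?d ^^ t) (cover_weight ?d (hamming l j))"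
  let ?S = "\<lambda>n. \<Sum>l\<in>UNIV. diffusion_matrix $ i $ l * ?F l n"
  have "(\<Sum>l\<in>UNIV. diffusion_matrix $ i $ l * (collect ?d ^^ Suc t) (cover_weight ?d (hamming l j)) n)
      = collect ?d ?S n"
    by (simp add: collect_def sum_distrib_left sum.distrib[symmetric] algebra_simps)
  also have "\<dots> = collect ?d (collect ?d (?F i)) n"
    using Suc.prems Suc.IH[of n] Suc.IH[of "Suc n"] by (intro collect_cong) auto
  finally show ?case by simp
qed

text \<open>With no coordinate picked, the weight is the identity matrix entry. Each left factor of
  the matrix then adds one \<open>collect\<close> step.\<close>

lemma matrix_power_diffusion:
  fixes i j :: "'d::finite hypercube"
  shows "matrix_power diffusion_matrix t $ i $ j
    = (collect CARD('d) ^^ t) (cover_weight CARD('d) (hamming i j)) 0"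
proof (induction t arbitrary: i)
  case 0
  then show ?case
    by (simp add: mat_def cover_weight_0[OF hamming_le] hamming_eq_0_iff)
next
  case (Suc t)
  then show ?case
    using diffusion_collect_iterate[of 0 i t j] by (simp add: matrix_matrix_mult_def)
qed

theorem mainTheorem6:
  fixes i j :: "'d::finite hypercube"
  shows "unimodal (\<lambda>t. matrix_power diffusion_matrix t $ i $ j)"
proof (rule unimodal_if_increments_cross_down)
  fix t u :: nat
  let ?d = "CARD('d)"
  let ?w = "cover_weight ?d (hamming i j)"
  let ?p = "\<lambda>t. matrix_power diffusion_matrix t $ i $ j"
  have incr: "?p (Suc t) - ?p t = (collect ?d ^^ t) (\<lambda>n. collect ?d ?w n - ?w n) 0" for t
    by (simp only: matrix_power_diffusion collect_iterate_increment)
  assume "?p (Suc t) - ?p t < 0" "t \<le> u"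
  then show "?p (Suc u) - ?p u \<le> 0"
    unfolding incr
    using collect_iterate_stays_nonpos cover_weight_increment_crosses_down[OF hamming_le]
      zero_less_card_finite by blast
qed

end
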